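(* Let $F:\mathbf{Met}\to\mathbf{Met}$ be the endofunctor given on objects by $F(M)=(M\mathbb{R})^{\mathbf{R}}_o$ with the interleaving distance, and on a $1$-Lipschitz map $f:M\to N$ by $F(f):U\mapsto f\mathbb{R}\circ U$. Then $F$ admits a natural transformation $\eta:\mathrm{I}_{\mathbf{Met}}\Rightarrow F$ from the identity endofunctor on $\mathbf{Met}$ such that, for each metric space $M$, $\eta_M:M\to F(M)$ is the isometric embedding of $M$ into the metric space of persistence modules with values in $M\mathbb{R}$ given by constant world lines: for each $x\in M$, $\eta_M(x)$ is the functor $\mathbf{R}\to M\mathbb{R}$ sending $s$ to $(x,s)$ and $s\le t$ to $(x,s)\le(x,t)$.
   Context: Metric spaces: here a metric $d$ is symmetric, satisfies $d(x,x)=0$ and the triangle inequality, may take the value $+\infty$, and may have $d(x,y)=0$ for $x\ne y$. $\mathbf{Met}$ is the category of such metric spaces whose underlying collection is a set, with $1$-Lipschitz maps ($d_N(f(x),f(y))\le d_M(x,y)$) as morphisms. An isometric embedding is a map preserving distances. For $(M,d)\in\mathbf{Met}$, the spacetime $M\mathbb{R}$ is the set $M\times\mathbb{R}$ with the preorder $(x,s)\le(y,t)\iff d(x,y)\le t-s$, regarded as a thin category (at most one morphism between two objects). For a $1$-Lipschitz map $f:M\to N$, the functor $f\mathbb{R}:M\mathbb{R}\to N\mathbb{R}$ is $(x,s)\mapsto(f(x),s)$. $\mathbf{R}$ is the poset category of $(\mathbb{R},\le)$. For a small category $\mathbf{C}$, $\mathbf{C}^{\mathbf{R}}_o$ is the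 set of functors $\mathbf{R}\to\mathbf{C}$ (persistence modules with values in $\mathbf{C}$; for $\mathbf{C}=M\mathbb{R}$ they are called world lines). For $e\ge0$, $T_e:\mathbf{R}\to\mathbf{R}$ is the translation functor $a\mapsto a+e$, and $\sigma_e:1_{\mathbf{R}}\Rightarrow T_e$ is the unique natural transformation. Functors $U,V:\mathbf{R}\to\mathbf{C}$ are $e$-interleaved if there are natural transformations $\Phi:U\Rightarrow VT_e$ and $\Psi:V\Rightarrow UT_e$ with $(\Psi T_e)\Phi=U\sigma_{2e}$ and $(\Phi T_e)\Psi=V\sigma_{2e}$. The interleaving distance is $d_{\mathrm{Int}}(U,V)=\inf\{e\ge0:U,V\text{ are }e\text{-interleaved}\}$ (equal to $\infty$ if there is none). It is known that $(\mathbf{C}^{\mathbf{R}}_o,d_{\mathrm{Int}})$ is a metric space in the sense that $d_{\mathrm{Int}}$ is symmetric, satisfies $d_{\mathrm{Int}}(U,U)=0$ and the triangle inequality, may take the value $+\infty$, and may have $d_{\mathrm{Int}}(U,V)=0$ for $U\ne V$, that post-composition with a functor is $1$-Lipschitz, and hence that $\mathbf{C}\mapsto\mathbf{C}^{\mathbf{R}}_o$ is a functor from the category $\mathbf{Cat}$ of small categories to $\mathbf{Met}$. $F$ is the composite of the spacetime functor $\mathbf{Met}\to\mathbf{Cat}$ with this functor. *)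

theory Defs
  imports "HOL-Library.Extended_Real" "HOL-Library.FuncSet"
begin

section \<open>Categories, functors, natural transformations\<close>

text \<open>Maps that belong to a category, a functor or a natural transformation are extensional
  (equal to \<open>undefined\<close> off their domain), so that HOL equality is the intended equality of
  functors and of natural transformations. Composition \<open>Comp C g f\<close> is in applicative order.\<close>

record ('o, 'm) cat =
  Obj :: "'o set"
  Arr :: "'m set"
  Dom :: "'m \<Rightarrow> 'o"
  Cod :: "'m \<Rightarrow> 'o"
  Ident :: "'o \<Rightarrow> 'm"
  Comp :: "'m \<Rightarrow> 'm \<Rightarrow> 'm"

definition Hom :: "('o, 'm) cat \<Rightarrow> 'o \<Rightarrow> 'o \<Rightarrow> 'm set" where
  "Hom C x y = {f \<in> Arr C. Dom C f = x \<and> Cod C f = y}"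

locale category =
  fixes C :: "('o, 'm) cat"
  assumes Dom_in: "f \<in> Arr C \<Longrightarrow> Dom C f \<in> Obj C"
    and Cod_in: "f \<in> Arr C \<Longrightarrow> Cod C f \<in> Obj C"
    and Ident_in: "x \<in> Obj C \<Longrightarrow> Ident C x \<in> Hom C x x"
    and Comp_in: "f \<in> Hom C x y \<Longrightarrow> g \<in> Hom C y z \<Longrightarrow> Comp C g f \<in> Hom C x z"
    and Comp_Ident: "f \<in> Hom C x y \<Longrightarrow> Comp C f (Ident C x) = f"
    and Ident_Comp: "f \<in> Hom C x y \<Longrightarrow> Comp C (Ident C y) f = f"
    and Comp_assoc: "f \<in> Hom C w x \<Longrightarrow> g \<in> Hom C x y \<Longrightarrow> h \<in> Hom C y z \<Longrightarrow>
          Comp C h (Comp C g f) = Comp C (Comp C h g) f"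

record ('o, 'm, 'p, 'n) cfunctor =
  ObMap :: "'o \<Rightarrow> 'p"
  ArrMap :: "'m \<Rightarrow> 'n"

locale cat_functor = A: category A + B: category B
  for A :: "('o, 'm) cat" and B :: "('p, 'n) cat" +
  fixes F :: "('o, 'm, 'p, 'n) cfunctor"
  assumes ObMap_in: "ObMap F \<in> Obj A \<rightarrow>\<^sub>E Obj B"
    and ArrMap_ext: "ArrMap F \<in> extensional (Arr A)"
    and ArrMap_in: "f \<in> Hom A x y \<Longrightarrow> ArrMap F f \<in> Hom B (ObMap F x) (ObMap F y)"
    and ArrMap_Ident: "x \<in> Obj A \<Longrightarrow> ArrMap F (Ident A x) = Ident B (ObMap F x)"
    and ArrMap_Comp: "f \<in> Hom A x y \<Longrightarrow> g \<in> Hom A y z \<Longrightarrow>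
          ArrMap F (Comp A g f) = Comp B (ArrMap F g) (ArrMap F f)"

definition id_functor :: "('o, 'm) cat \<Rightarrow> ('o, 'm, 'o, 'm) cfunctor" where
  "id_functor A = \<lparr>ObMap = (\<lambda>x\<in>Obj A. x), ArrMap = (\<lambda>f\<in>Arr A. f)\<rparr>"

text \<open>\<open>comp_functor A G F\<close> is \<open>G \<circ> F\<close>, where \<open>A\<close> is the source category of \<open>F\<close>.\<close>

definition comp_functor ::
    "('o, 'm) cat \<Rightarrow> ('p, 'n, 'q, 'k) cfunctor \<Rightarrow> ('o, 'm, 'p, 'n) cfunctor \<Rightarrow>
      ('o, 'm, 'q, 'k) cfunctor" where
  "comp_functor A G F =
    \<lparr>ObMap = (\<lambda>x\<in>Obj A. ObMap G (ObMap F x)), ArrMap = (\<lambda>f\<in>Arr A. ArrMap G (ArrMap F f))\<rparr>"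

locale nat_trans = F: cat_functor A B F + G: cat_functor A B G
  for A :: "('o, 'm) cat" and B :: "('p, 'n) cat"
    and F :: "('o, 'm, 'p, 'n) cfunctor" and G :: "('o, 'm, 'p, 'n) cfunctor" +
  fixes \<tau> :: "'o \<Rightarrow> 'n"
  assumes component_ext: "\<tau> \<in> extensional (Obj A)"
    and component_in: "x \<in> Obj A \<Longrightarrow> \<tau> x \<in> Hom B (ObMap F x) (ObMap G x)"
    and naturality: "f \<in> Hom A x y \<Longrightarrow> Comp B (\<tau> y) (ArrMap F f) = Comp B (ArrMap G f) (\<tau> x)"

text \<open>Vertical composition, and the whiskerings written \<open>\<tau>F\<close> and \<open>G\<tau>\<close> by juxtaposition;
  in each case \<open>A\<close> is the source category of the result.\<close>

definition vcomp :: "('o, 'm) cat \<Rightarrow> ('p, 'n) cat \<Rightarrow> ('o \<Rightarrow> 'n) \<Rightarrow> ('o \<Rightarrow> 'n) \<Rightarrow> 'o \<Rightarrow> 'n" where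
  "vcomp A B \<tau> \<rho> = (\<lambda>x\<in>Obj A. Comp B (\<tau> x) (\<rho> x))"

definition trans_functor ::
    "('o, 'm) cat \<Rightarrow> ('p \<Rightarrow> 'k) \<Rightarrow> ('o, 'm, 'p, 'n) cfunctor \<Rightarrow> 'o \<Rightarrow> 'k" where
  "trans_functor A \<tau> F = (\<lambda>x\<in>Obj A. \<tau> (ObMap F x))"

definition functor_trans ::
    "('o, 'm) cat \<Rightarrow> ('p, 'n, 'q, 'k) cfunctor \<Rightarrow> ('o \<Rightarrow> 'n) \<Rightarrow> 'o \<Rightarrow> 'k" where
  "functor_trans A G \<tau> = (\<lambda>x\<in>Obj A. ArrMap G (\<tau> x))"

text \<open>A preorder \<open>le\<close> on \<open>S\<close> as a thin category: the unique arrow from \<open>x\<close> to \<open>y\<close>, when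
  \<open>le x y\<close>, is the pair \<open>(x, y)\<close>.\<close>

definition thin_cat :: "'o set \<Rightarrow> ('o \<Rightarrow> 'o \<Rightarrow> bool) \<Rightarrow> ('o, 'o \<times> 'o) cat" where
  "thin_cat S le =
    \<lparr>Obj = S, Arr = {(x, y). x \<in> S \<and> y \<in> S \<and> le x y}, Dom = fst, Cod = snd,
     Ident = (\<lambda>x. (x, x)), Comp = (\<lambda>g f. (fst f, snd g))\<rparr>"

lemma category_thin_cat:
  assumes "\<And>x. x \<in> S \<Longrightarrow> le x x"
    and "\<And>x y z. x \<in> S \<Longrightarrow> y \<in> S \<Longrightarrow> z \<in> S \<Longrightarrow> le x y \<Longrightarrow> le y z \<Longrightarrow> le x z"
  shows "category (thin_cat S le)"
  by unfold_locales (auto simp: thin_cat_def Hom_def intro: assms)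


section \<open>Persistence modules and the interleaving distance\<close>

definition Rcat :: "(real, real \<times> real) cat" where
  "Rcat = thin_cat UNIV (\<le>)"

lemma category_Rcat: "category Rcat"
  unfolding Rcat_def by (rule category_thin_cat) auto

definition shift :: "real \<Rightarrow> (real, real \<times> real, real, real \<times> real) cfunctor" where
  "shift e = \<lparr>ObMap = (\<lambda>a. a + e), ArrMap = (\<lambda>(a, b)\<in>Arr Rcat. (a + e, b + e))\<rparr>"

text \<open>The unique natural transformation from the identity functor to \<open>shift e\<close>, for \<open>e \<ge> 0\<close>.\<close>

definition shift_trans :: "real \<Rightarrow> real \<Rightarrow> real \<times> real" where
  "shift_trans e a = (a, a + e)"

lemma nat_trans_shift_trans:
  assumes "0 \<le> e"
  shows "nat_trans Rcat Rcat (id_functor Rcat) (shift e) (shift_trans e)"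
proof -
  interpret category Rcat by (rule category_Rcat)
  show ?thesis using assms
    by unfold_locales
      (auto simp: Rcat_def thin_cat_def shift_def shift_trans_def id_functor_def Hom_def)
qed

type_synonym ('o, 'm) pmodule = "(real, real \<times> real, 'o, 'm) cfunctor"

definition pmodules :: "('o, 'm) cat \<Rightarrow> ('o, 'm) pmodule set" where
  "pmodules C = {U. cat_functor Rcat C U}"

definition interleaved ::
    "('o, 'm) cat \<Rightarrow> real \<Rightarrow> ('o, 'm) pmodule \<Rightarrow> ('o, 'm) pmodule \<Rightarrow> bool" where
  "interleaved C e U V \<longleftrightarrow> (\<exists>\<Phi> \<Psi>.
     nat_trans Rcat C U (comp_functor Rcat V (shift e)) \<Phi> \<and>
     nat_trans Rcat C V (comp_functor Rcat U (shift e)) \<Psi> \<and>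
     vcomp Rcat C (trans_functor Rcat \<Psi> (shift e)) \<Phi> = functor_trans Rcat U (shift_trans (2 * e)) \<and>
     vcomp Rcat C (trans_functor Rcat \<Phi> (shift e)) \<Psi> = functor_trans Rcat V (shift_trans (2 * e)))"

definition interleaving_dist ::
    "('o, 'm) cat \<Rightarrow> ('o, 'm) pmodule \<Rightarrow> ('o, 'm) pmodule \<Rightarrow> ereal" where
  "interleaving_dist C U V = (INF e \<in> {e. 0 \<le> e \<and> interleaved C e U V}. ereal e)"


section \<open>Metric spaces and spacetimes\<close>

record 'a mspace =
  points :: "'a set"
  mdist :: "'a \<Rightarrow> 'a \<Rightarrow> ereal"

text \<open>Extended pseudometrics. Nonnegativity is listed because of \<open>-\<infinity> :: ereal\<close>.\<close>

locale metric_sp =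
  fixes M :: "'a mspace"
  assumes dist_nonneg: "x \<in> points M \<Longrightarrow> y \<in> points M \<Longrightarrow> 0 \<le> mdist M x y"
    and dist_refl: "x \<in> points M \<Longrightarrow> mdist M x x = 0"
    and dist_sym: "x \<in> points M \<Longrightarrow> y \<in> points M \<Longrightarrow> mdist M x y = mdist M y x"
    and dist_triangle: "x \<in> points M \<Longrightarrow> y \<in> points M \<Longrightarrow> z \<in> points M \<Longrightarrow>
          mdist M x z \<le> mdist M x y + mdist M y z"

text \<open>The category of metric spaces is not reified as a \<open>cat\<close>: its objects range over all
  types \<open>'a mspace\<close>. Its morphisms are \<open>met_hom\<close> below, its identities \<open>met_id\<close>, and its
  composition is \<open>compose\<close> from FuncSet.\<close>

definition met_hom :: "'a mspace \<Rightarrow> 'b mspace \<Rightarrow> ('a \<Rightarrow> 'b) set" where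
  "met_hom M N = {f \<in> points M \<rightarrow>\<^sub>E points N.
     \<forall>x\<in>points M. \<forall>y\<in>points M. mdist N (f x) (f y) \<le> mdist M x y}"

definition met_id :: "'a mspace \<Rightarrow> 'a \<Rightarrow> 'a" where
  "met_id M = (\<lambda>x\<in>points M. x)"

definition isometric_embedding :: "'a mspace \<Rightarrow> 'b mspace \<Rightarrow> ('a \<Rightarrow> 'b) \<Rightarrow> bool" where
  "isometric_embedding M N f \<longleftrightarrow> f \<in> points M \<rightarrow>\<^sub>E points N \<and>
     (\<forall>x\<in>points M. \<forall>y\<in>points M. mdist N (f x) (f y) = mdist M x y)"

type_synonym 'a event = "'a \<times> real"

definition spacetime_le :: "'a mspace \<Rightarrow> 'a event \<Rightarrow> 'a event \<Rightarrow> bool" where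
  "spacetime_le M = (\<lambda>(x, s) (y, t). mdist M x y \<le> ereal (t - s))"

definition spacetime :: "'a mspace \<Rightarrow> ('a event, 'a event \<times> 'a event) cat" where
  "spacetime M = thin_cat (points M \<times> UNIV) (spacetime_le M)"

lemma category_spacetime:
  assumes "metric_sp M" shows "category (spacetime M)"
  unfolding spacetime_def
proof (rule category_thin_cat)
  interpret metric_sp M by (rule assms)
  fix p assume "p \<in> points M \<times> (UNIV :: real set)"
  then show "spacetime_le M p p" by (auto simp: spacetime_le_def dist_refl zero_ereal_def)
next
  interpret metric_sp M by (rule assms)
  fix p q r assume "p \<in> points M \<times> (UNIV :: real set)" "q \<in> points M \<times> (UNIV :: real set)"
    "r \<in> points M \<times> (UNIV :: real set)" and le: "spacetime_le M p q" "spacetime_le M q r"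
  then obtain x s y t z u where p: "p = (x, s)" "q = (y, t)" "r = (z, u)"
    and "x \<in> points M" "y \<in> points M" "z \<in> points M" by auto
  then have "mdist M x z \<le> mdist M x y + mdist M y z" by (intro dist_triangle)
  also have "\<dots> \<le> ereal (t - s) + ereal (u - t)"
    using le unfolding p spacetime_le_def by (intro add_mono) auto
  finally show "spacetime_le M p r" unfolding p spacetime_le_def by simp
qed

definition spacetime_map :: "'a mspace \<Rightarrow> ('a \<Rightarrow> 'b) \<Rightarrow>
    ('a event, 'a event \<times> 'a event, 'b event, 'b event \<times> 'b event) cfunctor" where
  "spacetime_map M f =
    \<lparr>ObMap = (\<lambda>(x, s)\<in>Obj (spacetime M). (f x, s)),
     ArrMap = (\<lambda>((x, s), (y, t))\<in>Arr (spacetime M). ((f x, s), (f y, t)))\<rparr>"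

lemma cat_functor_spacetime_map:
  assumes "metric_sp M" "metric_sp N" "f \<in> met_hom M N"
  shows "cat_functor (spacetime M) (spacetime N) (spacetime_map M f)"
proof -
  interpret A: category "spacetime M" by (rule category_spacetime[OF assms(1)])
  interpret B: category "spacetime N" by (rule category_spacetime[OF assms(2)])
  interpret M: metric_sp M by (rule assms(1))
  have le: "mdist N (f x) (f y) \<le> ereal e"
    if "x \<in> points M" "y \<in> points M" "mdist M x y \<le> ereal e" for x y e
    using that assms(3) order_trans unfolding met_hom_def by blast
  have pt: "f x \<in> points N" if "x \<in> points M" for x
    using that assms(3) unfolding met_hom_def by auto
  have tr: "mdist M x z \<le> ereal (u - s)"
    if "x \<in> points M" "y \<in> points M" "z \<in> points M"
      "mdist M x y \<le> ereal (t - s)" "mdist M y z \<le> ereal (u - t)" for x y z s t u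
    using M.dist_triangle[OF that(1-3)] add_mono[OF that(4,5)] by (simp add: order_trans)
  show ?thesis
    by unfold_locales
      (auto simp: spacetime_def thin_cat_def spacetime_map_def Hom_def spacetime_le_def
        M.dist_refl zero_ereal_def[symmetric] le pt intro: tr)
qed


section \<open>The endofunctor and the constant world lines\<close>

text \<open>The functor \<open>C \<mapsto> C\<^sup>R\<close> from small categories to metric spaces, on objects and on a
  functor \<open>G\<close> with source \<open>C\<close>.\<close>

definition pmodule_space :: "('o, 'm) cat \<Rightarrow> ('o, 'm) pmodule mspace" where
  "pmodule_space C = \<lparr>points = pmodules C, mdist = interleaving_dist C\<rparr>"

definition pmodule_map :: "('o, 'm) cat \<Rightarrow> ('o, 'm, 'p, 'n) cfunctor \<Rightarrow>
    ('o, 'm) pmodule \<Rightarrow> ('p, 'n) pmodule" where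
  "pmodule_map C G = (\<lambda>U\<in>pmodules C. comp_functor Rcat G U)"

type_synonym 'a world_line = "('a event, 'a event \<times> 'a event) pmodule"

definition F_obj :: "'a mspace \<Rightarrow> 'a world_line mspace" where
  "F_obj M = pmodule_space (spacetime M)"

definition F_map :: "'a mspace \<Rightarrow> ('a \<Rightarrow> 'b) \<Rightarrow> 'a world_line \<Rightarrow> 'b world_line" where
  "F_map M f = pmodule_map (spacetime M) (spacetime_map M f)"

definition const_world_line :: "'a \<Rightarrow> 'a world_line" where
  "const_world_line x =
    \<lparr>ObMap = (\<lambda>s. (x, s)), ArrMap = (\<lambda>(s, t)\<in>Arr Rcat. ((x, s), (x, t)))\<rparr>"

definition eta :: "'a mspace \<Rightarrow> 'a \<Rightarrow> 'a world_line" where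
  "eta M = (\<lambda>x\<in>points M. const_world_line x)"

end

theory Submission
  imports Defs
begin

text \<open>In a thin category a natural transformation is determined by its source and target, and every
  diagram commutes. Hence world lines \<open>U\<close>, \<open>V\<close> are \<open>e\<close>-interleaved iff \<open>U a \<le> V (a + e)\<close> and
  \<open>V a \<le> U (a + e)\<close> for all \<open>a\<close>. For constant world lines at \<open>x\<close> and \<open>y\<close> this says
  \<open>d(x, y) \<le> e\<close>, whose infimum over \<open>e \<ge> 0\<close> is \<open>d(x, y)\<close>.\<close>

section \<open>Persistence modules in thin categories\<close>

text \<open>What follows assumes only \<open>category (thin_cat S le)\<close>. The preorder laws of
  \<open>le\<close> on \<open>S\<close> are recovered from identities here and from composition in
  the next lemma.\<close>

lemma thin_cat_refl:
  assumes "category (thin_cat S le)" "x \<in> S"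
  shows "le x x"
  using category.Ident_in[OF assms(1), of x] assms(2) by (auto simp: thin_cat_def Hom_def)

lemma thin_cat_trans:
  assumes "category (thin_cat S le)" "x \<in> S" "y \<in> S" "z \<in> S" "le x y" "le y z"
  shows "le x z"
  using category.Comp_in[OF assms(1), of "(x, y)" x y "(y, z)" z] assms(2-)
  by (auto simp: thin_cat_def Hom_def)

lemma Obj_Rcat [simp]: "Obj Rcat = UNIV"
  by (simp add: Rcat_def thin_cat_def)

lemma Arr_Rcat [simp]: "Arr Rcat = {(s, t). s \<le> t}"
  by (simp add: Rcat_def thin_cat_def)

text \<open>A functor from \<open>Rcat\<close> to a thin category carries no data beyond its object
  map, so persistence modules are handled as real-indexed paths, turned back into functors by
  \<open>path_pmodule\<close>.\<close>

definition monotone_path :: "'o set \<Rightarrow> ('o \<Rightarrow> 'o \<Rightarrow> bool) \<Rightarrow> (real \<Rightarrow> 'o) \<Rightarrow> bool" where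
  "monotone_path S le u \<longleftrightarrow> range u \<subseteq> S \<and> monotone (\<le>) le u"

definition path_pmodule :: "(real \<Rightarrow> 'o) \<Rightarrow> ('o, 'o \<times> 'o) pmodule" where
  "path_pmodule u = \<lparr>ObMap = u, ArrMap = (\<lambda>(s, t)\<in>Arr Rcat. (u s, u t))\<rparr>"

lemma ObMap_path_pmodule [simp]: "ObMap (path_pmodule u) = u"
  by (simp add: path_pmodule_def)

lemma cat_functor_path_pmodule:
  assumes "category (thin_cat S le)" "monotone_path S le u"
  shows "cat_functor Rcat (thin_cat S le) (path_pmodule u)"
proof -
  interpret A: category Rcat by (rule category_Rcat)
  interpret B: category "thin_cat S le" by (rule assms(1))
  show ?thesis using assms(2)
    by unfold_locales
      (auto simp: path_pmodule_def monotone_path_def Hom_def Rcat_def thin_cat_def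
        intro!: thin_cat_refl[OF assms(1)] dest: monotoneD)
qed

text \<open>The arrow from \<open>s\<close> to \<open>t\<close> must go to an arrow with prescribed
  ends, and the pair of these ends is the only candidate. Off \<open>Arr Rcat\<close> the arrow map
  is fixed by extensionality.\<close>

lemma cat_functor_thin_catE:
  assumes "cat_functor Rcat (thin_cat S le) U"
  obtains u where "U = path_pmodule u" "monotone_path S le u"
proof
  interpret U: cat_functor Rcat "thin_cat S le" U by (rule assms)
  have arr: "ArrMap U (s, t) = (ObMap U s, ObMap U t) \<and> le (ObMap U s) (ObMap U t)"
    if "s \<le> t" for s t
    using U.ArrMap_in[of "(s, t)" s t] that
    by (auto simp: Hom_def Rcat_def thin_cat_def prod_eq_iff)
  have "ArrMap U = (\<lambda>(s, t)\<in>Arr Rcat. (ObMap U s, ObMap U t))"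
    using U.ArrMap_ext arr by (auto simp: fun_eq_iff extensional_def)
  then show "U = path_pmodule (ObMap U)"
    by (simp add: path_pmodule_def)
  show "monotone_path S le (ObMap U)"
    using U.ObMap_in arr by (auto simp: monotone_path_def monotone_def thin_cat_def)
qed

lemma pmodules_thin_cat:
  assumes "category (thin_cat S le)"
  shows "pmodules (thin_cat S le) = path_pmodule ` {u. monotone_path S le u}"
  using assms by (auto simp: pmodules_def intro: cat_functor_path_pmodule elim: cat_functor_thin_catE)

lemma comp_functor_path_pmodule_shift:
  "comp_functor Rcat (path_pmodule u) (shift e) = path_pmodule (\<lambda>a. u (a + e))"
  by (auto simp: comp_functor_def path_pmodule_def shift_def fun_eq_iff)

lemma monotone_path_shift:
  "monotone_path S le u \<Longrightarrow> monotone_path S le (\<lambda>a. u (a + e))"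
  by (auto simp: monotone_path_def monotone_def)

text \<open>Each component lies in a hom-set with at most one element. Naturality is automatic: both
  sides of a square are the pair of its outer corners.\<close>

lemma nat_trans_path_pmodule_iff:
  assumes "category (thin_cat S le)" "monotone_path S le u" "monotone_path S le v"
  shows "nat_trans Rcat (thin_cat S le) (path_pmodule u) (path_pmodule v) \<tau> \<longleftrightarrow>
    \<tau> = (\<lambda>a. (u a, v a)) \<and> (\<forall>a. le (u a) (v a))"
proof
  assume "nat_trans Rcat (thin_cat S le) (path_pmodule u) (path_pmodule v) \<tau>"
  then interpret nat_trans Rcat "thin_cat S le" "path_pmodule u" "path_pmodule v" \<tau> .
  have "\<tau> a = (u a, v a) \<and> le (u a) (v a)" for a
    using component_in[of a] by (auto simp: Hom_def thin_cat_def prod_eq_iff)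
  then show "\<tau> = (\<lambda>a. (u a, v a)) \<and> (\<forall>a. le (u a) (v a))" by auto
next
  assume \<tau>: "\<tau> = (\<lambda>a. (u a, v a)) \<and> (\<forall>a. le (u a) (v a))"
  interpret F: cat_functor Rcat "thin_cat S le" "path_pmodule u"
    using assms by (intro cat_functor_path_pmodule)
  interpret G: cat_functor Rcat "thin_cat S le" "path_pmodule v"
    using assms by (intro cat_functor_path_pmodule)
  show "nat_trans Rcat (thin_cat S le) (path_pmodule u) (path_pmodule v) \<tau>"
    using \<tau> assms(2,3)
    by unfold_locales
      (auto simp: Hom_def thin_cat_def Rcat_def path_pmodule_def monotone_path_def)
qed

lemma interleaved_path_pmodule_iff:
  assumes "category (thin_cat S le)" "monotone_path S le u" "monotone_path S le v" "0 \<le> e"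
  shows "interleaved (thin_cat S le) e (path_pmodule u) (path_pmodule v) \<longleftrightarrow>
    (\<forall>a. le (u a) (v (a + e)) \<and> le (v a) (u (a + e)))"
  unfolding interleaved_def comp_functor_path_pmodule_shift
    nat_trans_path_pmodule_iff[OF assms(1,2) monotone_path_shift[OF assms(3)]]
    nat_trans_path_pmodule_iff[OF assms(1,3) monotone_path_shift[OF assms(2)]]
  \<comment> \<open>The forced \<Phi> and \<Psi> satisfy the interleaving identities, since both
    sides have the same ends. The sign of \<open>e\<close> makes \<open>(a, a + 2 * e)\<close> an
    arrow of \<open>Rcat\<close>; otherwise the extensional arrow map would return
    \<open>undefined\<close>.\<close>
  using assms(4)
  by (simp add: vcomp_def trans_functor_def functor_trans_def shift_def shift_trans_def
      thin_cat_def path_pmodule_def add.assoc flip: mult_2) auto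

section \<open>The interleaving distance over an arbitrary category\<close>

lemma interleaving_dist_sym: "interleaving_dist C U V = interleaving_dist C V U"
proof -
  have "interleaved C e U V \<longleftrightarrow> interleaved C e V U" for e
    unfolding interleaved_def by blast
  then show ?thesis by (simp add: interleaving_dist_def)
qed

lemma interleaving_dist_nonneg: "0 \<le> interleaving_dist C U V"
  by (auto simp: interleaving_dist_def intro: INF_greatest)

lemma interleaving_dist_le:
  "0 \<le> e \<Longrightarrow> interleaved C e U V \<Longrightarrow> interleaving_dist C U V \<le> ereal e"
  by (auto simp: interleaving_dist_def intro: INF_lower)

lemma interleaving_dist_mono:
  assumes "\<And>e. 0 \<le> e \<Longrightarrow> interleaved C e U V \<Longrightarrow> interleaved D e U' V'"
  shows "interleaving_dist D U' V' \<le> interleaving_dist C U V"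
  using assms by (auto simp: interleaving_dist_def intro!: INF_superset_mono)

lemma interleaving_dist_lessE:
  assumes "interleaving_dist C U V < r"
  obtains e where "0 \<le> e" "interleaved C e U V" "ereal e < r"
  using assms by (auto simp: interleaving_dist_def INF_less_iff)

text \<open>The infima need not be attained, so every \<open>r\<close> above the sum is approached
  by actual interleavings. Additivity of interleavings is a hypothesis, to be discharged for thin
  categories only.\<close>

lemma interleaving_dist_triangle:
  assumes "\<And>d e. 0 \<le> d \<Longrightarrow> 0 \<le> e \<Longrightarrow> interleaved C d U V \<Longrightarrow> interleaved C e V W \<Longrightarrow>
    interleaved C (d + e) U W"
  shows "interleaving_dist C U W \<le> interleaving_dist C U V + interleaving_dist C V W"
proof (rule dense_ge)
  fix r assume "interleaving_dist C U V + interleaving_dist C V W < r"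
  \<comment> \<open>Moving a summand across the inequality in \<open>ereal\<close> requires it to be
    finite, which the strict bound by \<open>r\<close> guarantees.\<close>
  then have "interleaving_dist C V W \<noteq> \<infinity> \<and>
      interleaving_dist C U V < r - interleaving_dist C V W"
    using interleaving_dist_nonneg[of C U V] interleaving_dist_nonneg[of C V W]
    by (cases "interleaving_dist C U V"; cases "interleaving_dist C V W"; cases r) auto
  then have fin: "interleaving_dist C V W \<noteq> \<infinity>"
    and "interleaving_dist C U V < r - interleaving_dist C V W" by auto
  from this(2) obtain d where d: "0 \<le> d" "interleaved C d U V" "ereal d < r - interleaving_dist C V W"
    by (rule interleaving_dist_lessE)
  then have "interleaving_dist C V W < r - ereal d"
    using fin interleaving_dist_nonneg[of C V W]
    by (cases "interleaving_dist C V W"; cases r) auto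
  then obtain e where e: "0 \<le> e" "interleaved C e V W" "ereal e < r - ereal d"
    by (rule interleaving_dist_lessE)
  have "interleaving_dist C U W \<le> ereal (d + e)"
    using d e by (intro interleaving_dist_le assms) auto
  also have "\<dots> \<le> r"
    using e by (cases r) auto
  finally show "interleaving_dist C U W \<le> r" .
qed

text \<open>Reflexivity of \<open>le\<close> makes a path 0-interleaved with itself, and
  transitivity makes interleaving parameters add up.\<close>

lemma metric_sp_pmodule_space_thin_cat:
  assumes cat: "category (thin_cat S le)"
  shows "metric_sp (pmodule_space (thin_cat S le))"
proof
  let ?C = "thin_cat S le"
  fix U assume "U \<in> points (pmodule_space ?C)"
  then obtain u where U: "U = path_pmodule u" "monotone_path S le u"
    by (auto simp: pmodule_space_def pmodules_thin_cat[OF cat])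
  then have "interleaved ?C 0 U U"
    by (auto simp: interleaved_path_pmodule_iff[OF cat] monotone_path_def
        intro: thin_cat_refl[OF cat])
  then have "interleaving_dist ?C U U \<le> 0"
    using interleaving_dist_le[of 0 ?C U U] by (simp add: zero_ereal_def)
  then show "mdist (pmodule_space ?C) U U = 0"
    using interleaving_dist_nonneg[of ?C U U] by (simp add: pmodule_space_def)
next
  let ?C = "thin_cat S le"
  fix U V W
  assume "U \<in> points (pmodule_space ?C)" "V \<in> points (pmodule_space ?C)"
    "W \<in> points (pmodule_space ?C)"
  then obtain u v w where U: "U = path_pmodule u" "monotone_path S le u"
    and V: "V = path_pmodule v" "monotone_path S le v"
    and W: "W = path_pmodule w" "monotone_path S le w"
    by (auto simp: pmodule_space_def pmodules_thin_cat[OF cat])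
  have in_S: "u a \<in> S" "v a \<in> S" "w a \<in> S" for a
    using U V W by (auto simp: monotone_path_def)
  have "interleaved ?C (d + e) U W"
    if "0 \<le> d" "0 \<le> e" and UV: "interleaved ?C d U V" and VW: "interleaved ?C e V W" for d e
  proof -
    have uv: "le (u a) (v (a + d))" "le (v a) (u (a + d))"
      and vw: "le (v a) (w (a + e))" "le (w a) (v (a + e))" for a
      using that U V W by (auto simp: interleaved_path_pmodule_iff[OF cat])
    have "le (u a) (w (a + (d + e)))" for a
      using thin_cat_trans[OF cat in_S(1,2,3) uv(1) vw(1)] by (simp add: add.assoc)
    moreover have "le (w a) (u (a + (d + e)))" for a
      using thin_cat_trans[OF cat in_S(3,2,1) vw(2) uv(2)] by (simp add: ac_simps)
    ultimately show ?thesis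
      using that U W by (simp add: interleaved_path_pmodule_iff[OF cat])
  qed
  then show "mdist (pmodule_space ?C) U W \<le>
      mdist (pmodule_space ?C) U V + mdist (pmodule_space ?C) V W"
    by (simp add: pmodule_space_def interleaving_dist_triangle)
qed (auto simp: pmodule_space_def interleaving_dist_nonneg interleaving_dist_sym)

section \<open>World lines\<close>

abbreviation world_path :: "'a mspace \<Rightarrow> (real \<Rightarrow> 'a event) \<Rightarrow> bool" where
  "world_path M \<equiv> monotone_path (points M \<times> UNIV) (spacetime_le M)"

lemma metric_sp_F_obj: "metric_sp M \<Longrightarrow> metric_sp (F_obj M)"
  using category_spacetime[of M]
  by (simp add: F_obj_def spacetime_def metric_sp_pmodule_space_thin_cat)

lemma mdist_F_obj [simp]: "mdist (F_obj M) = interleaving_dist (spacetime M)"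
  by (simp add: F_obj_def pmodule_space_def)

lemma points_F_obj:
  "metric_sp M \<Longrightarrow> points (F_obj M) = path_pmodule ` {u. world_path M u}"
  using category_spacetime[of M]
  by (simp add: F_obj_def pmodule_space_def spacetime_def pmodules_thin_cat)

lemma interleaved_spacetime_iff:
  assumes "metric_sp M" "world_path M u" "world_path M v" "0 \<le> e"
  shows "interleaved (spacetime M) e (path_pmodule u) (path_pmodule v) \<longleftrightarrow>
    (\<forall>a. spacetime_le M (u a) (v (a + e)) \<and> spacetime_le M (v a) (u (a + e)))"
  using interleaved_path_pmodule_iff category_spacetime[OF assms(1)] assms(2-)
  unfolding spacetime_def by blast

section \<open>The action of \<open>F\<close> on 1-Lipschitz maps\<close>

lemma spacetime_le_apfst:
  assumes "f \<in> met_hom M N" "p \<in> points M \<times> UNIV" "q \<in> points M \<times> UNIV" "spacetime_le M p q"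
  shows "spacetime_le N (apfst f p) (apfst f q)"
proof -
  obtain x s y t where "p = (x, s)" "q = (y, t)" by (metis prod.exhaust)
  \<comment> \<open>\<open>apfst f\<close> moves the point and keeps the time: distances can only
    shrink, while the time difference that bounds them is unchanged.\<close>
  moreover have "mdist N (f x) (f y) \<le> mdist M x y" if "x \<in> points M" "y \<in> points M" for x y
    using that assms(1) by (auto simp: met_hom_def)
  ultimately show ?thesis
    using assms(2-) by (auto simp: spacetime_le_def intro: order_trans)
qed

lemma world_path_apfst:
  assumes "f \<in> met_hom M N" "world_path M u"
  shows "world_path N (\<lambda>s. apfst f (u s))"
  unfolding monotone_path_def
proof
  have u: "u s \<in> points M \<times> UNIV" for s
    using assms(2) by (auto simp: monotone_path_def)
  have "apfst f p \<in> points N \<times> UNIV" if "p \<in> points M \<times> UNIV" for p :: "'a event"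
    using that assms(1) by (auto simp: met_hom_def)
  with u show "range (\<lambda>s. apfst f (u s)) \<subseteq> points N \<times> UNIV" by blast
  show "monotone (\<le>) (spacetime_le N) (\<lambda>s. apfst f (u s))"
    using assms u by (auto simp: monotone_path_def monotone_def intro: spacetime_le_apfst)
qed

text \<open>The restrictions built into \<open>F_map\<close> have no effect here, because the path
  stays among the events and its steps among the arrows of the spacetime.\<close>

lemma F_map_path_pmodule:
  assumes "metric_sp M" "world_path M u"
  shows "F_map M f (path_pmodule u) = path_pmodule (\<lambda>s. apfst f (u s))"
proof -
  have "path_pmodule u \<in> pmodules (spacetime M)"
    using assms points_F_obj[OF assms(1)] by (auto simp: F_obj_def pmodule_space_def)
  moreover have "u s \<in> points M \<times> UNIV" "s \<le> t \<Longrightarrow> spacetime_le M (u s) (u t)" for s t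
    using assms(2) by (auto simp: monotone_path_def monotone_def)
  ultimately show ?thesis
    by (auto simp: F_map_def pmodule_map_def comp_functor_def spacetime_map_def path_pmodule_def
        spacetime_def thin_cat_def fun_eq_iff apfst_def map_prod_def mem_Times_iff
        split: prod.splits)
qed

lemma F_map_extensional: "F_map M f \<in> extensional (points (F_obj M))"
  by (simp add: F_map_def pmodule_map_def F_obj_def pmodule_space_def)

text \<open>An interleaving of paths is a family of order relations, and \<open>apfst f\<close>
  preserves these. Hence every \<open>e\<close> that interleaves two world lines also interleaves
  their images.\<close>

lemma F_map_met_hom:
  assumes "metric_sp M" "metric_sp N" "f \<in> met_hom M N"
  shows "F_map M f \<in> met_hom (F_obj M) (F_obj N)"
proof -
  have "F_map M f U \<in> points (F_obj N)" if "U \<in> points (F_obj M)" for U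
    using that assms by (auto simp: points_F_obj F_map_path_pmodule intro: world_path_apfst)
  moreover have "mdist (F_obj N) (F_map M f U) (F_map M f V) \<le> mdist (F_obj M) U V"
    if UV: "U \<in> points (F_obj M)" "V \<in> points (F_obj M)" for U V
  proof -
    obtain u v where U: "U = path_pmodule u" "world_path M u"
      and V: "V = path_pmodule v" "world_path M v"
      using UV assms(1) by (auto simp: points_F_obj)
    have "u a \<in> points M \<times> UNIV" "v a \<in> points M \<times> UNIV" for a
      using U V by (auto simp: monotone_path_def)
    with U V show ?thesis
      using assms
      by (auto simp: F_map_path_pmodule interleaved_spacetime_iff world_path_apfst
          intro!: interleaving_dist_mono spacetime_le_apfst)
  qed
  ultimately show ?thesis
    using F_map_extensional[of M f] by (auto simp: met_hom_def PiE_def)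
qed

lemma F_map_met_id:
  assumes "metric_sp M"
  shows "F_map M (met_id M) = met_id (F_obj M)"
proof (rule extensionalityI[OF F_map_extensional])
  fix U assume "U \<in> points (F_obj M)"
  moreover from this obtain u where U: "U = path_pmodule u" "world_path M u"
    using assms by (auto simp: points_F_obj)
  \<comment> \<open>\<open>met_id M\<close> is the identity on \<open>points M\<close> only, so this
    relies on the path lying over \<open>points M\<close>.\<close>
  moreover have "apfst (met_id M) (u s) = u s" for s
    using U by (auto simp: monotone_path_def met_id_def prod_eq_iff mem_Times_iff image_subset_iff)
  ultimately show "F_map M (met_id M) U = met_id (F_obj M) U"
    using assms by (simp add: F_map_path_pmodule met_id_def)
qed (simp add: met_id_def)

lemma F_map_compose:
  assumes "metric_sp M" "metric_sp N" "f \<in> met_hom M N"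
  shows "F_map M (compose (points M) g f) = compose (points (F_obj M)) (F_map N g) (F_map M f)"
proof (rule extensionalityI[OF F_map_extensional compose_extensional])
  fix U assume mem: "U \<in> points (F_obj M)"
  then obtain u where U: "U = path_pmodule u" "world_path M u"
    using assms by (auto simp: points_F_obj)
  have "apfst (compose (points M) g f) (u s) = apfst g (apfst f (u s))" for s
    using U
    by (auto simp: monotone_path_def compose_def prod_eq_iff mem_Times_iff image_subset_iff)
  then show "F_map M (compose (points M) g f) U =
      compose (points (F_obj M)) (F_map N g) (F_map M f) U"
    using assms U mem world_path_apfst[OF assms(3) U(2)]
    by (simp add: F_map_path_pmodule compose_eq)
qed

section \<open>Constant world lines and the transformation \<open>eta\<close>\<close>

lemma const_world_line_eq: "const_world_line x = path_pmodule (\<lambda>s. (x, s))"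
  by (simp add: const_world_line_def path_pmodule_def)

lemma world_path_const:
  assumes "metric_sp M" "x \<in> points M"
  shows "world_path M (\<lambda>s. (x, s))"
  using assms
  by (auto simp: monotone_path_def monotone_def spacetime_le_def metric_sp.dist_refl)

lemma eta_eq: "x \<in> points M \<Longrightarrow> eta M x = path_pmodule (\<lambda>s. (x, s))"
  by (simp add: eta_def const_world_line_eq)

text \<open>A finite \<open>d\<close> belongs to the index set, so the infimum is attained. For
  infinite \<open>d\<close> the set is empty, and its infimum is \<infinity>.\<close>

lemma INF_ereal_upper_bounds:
  fixes d :: ereal
  assumes "0 \<le> d"
  shows "(INF e \<in> {e. 0 \<le> e \<and> d \<le> ereal e}. ereal e) = d"
proof (rule antisym)
  show "(INF e \<in> {e. 0 \<le> e \<and> d \<le> ereal e}. ereal e) \<le> d"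
    using assms by (cases d) (auto intro: INF_lower)
qed (auto intro: INF_greatest)

lemma isometric_embedding_eta:
  assumes "metric_sp M"
  shows "isometric_embedding M (F_obj M) (eta M)"
proof -
  interpret metric_sp M by (rule assms)
  have "eta M \<in> points M \<rightarrow>\<^sub>E points (F_obj M)"
    using assms by (auto simp: eta_eq points_F_obj world_path_const) (simp add: eta_def)
  moreover have "mdist (F_obj M) (eta M x) (eta M y) = mdist M x y"
    if "x \<in> points M" "y \<in> points M" for x y
  proof -
    \<comment> \<open>The events compared have times \<open>a\<close> and \<open>a + e\<close>,
      whose difference does not depend on \<open>a\<close>; the conditions for all \<open>a\<close>
      collapse to one inequality.\<close>
    have "interleaved (spacetime M) e (eta M x) (eta M y) \<longleftrightarrow> mdist M x y \<le> ereal e"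
      if "0 \<le> e" for e
      using that \<open>x \<in> points M\<close> \<open>y \<in> points M\<close> assms
      by (simp add: eta_eq interleaved_spacetime_iff world_path_const)
        (simp add: spacetime_le_def dist_sym[of y x])
    then show ?thesis
      using INF_ereal_upper_bounds[OF dist_nonneg[OF that]]
      by (simp add: interleaving_dist_def cong: conj_cong)
  qed
  ultimately show ?thesis by (simp add: isometric_embedding_def)
qed

lemma isometric_embedding_met_hom: "isometric_embedding M N f \<Longrightarrow> f \<in> met_hom M N"
  by (simp add: isometric_embedding_def met_hom_def)

text \<open>Leaving time alone, \<open>apfst f\<close> turns the constant world line at
  \<open>x\<close> into the one at \<open>f x\<close>.\<close>

lemma eta_natural:
  assumes "metric_sp M" "f \<in> met_hom M N"
  shows "compose (points M) (F_map M f) (eta M) = compose (points M) (eta N) f"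
proof (rule extensionalityI[OF compose_extensional compose_extensional])
  fix x assume x: "x \<in> points M"
  then have "f x \<in> points N"
    using assms(2) by (auto simp: met_hom_def)
  with x show "compose (points M) (F_map M f) (eta M) x = compose (points M) (eta N) f x"
    using assms(1) by (simp add: compose_eq eta_eq F_map_path_pmodule world_path_const)
qed

text \<open>The objects of Met range over all types, so functoriality and naturality are spelled out
  as laws for arbitrary spaces over three type variables.\<close>

theorem theorem2p4:
  fixes M :: "'a mspace" and N :: "'b mspace" and L :: "'c mspace"
  assumes "metric_sp M" and "metric_sp N" and "metric_sp L"
  shows
    "(metric_sp (F_obj M) \<and>
      (\<forall>f\<in>met_hom M N. F_map M f \<in> met_hom (F_obj M) (F_obj N)) \<and>
      F_map M (met_id M) = met_id (F_obj M) \<and>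
      (\<forall>f\<in>met_hom M N. \<forall>g\<in>met_hom N L.
         F_map M (compose (points M) g f) = compose (points (F_obj M)) (F_map N g) (F_map M f))) \<and>
     (eta M \<in> met_hom M (F_obj M) \<and>
      (\<forall>f\<in>met_hom M N. compose (points M) (F_map M f) (eta M) = compose (points M) (eta N) f)) \<and>
     isometric_embedding M (F_obj M) (eta M) \<and>
     (\<forall>x\<in>points M. cat_functor Rcat (spacetime M) (eta M x) \<and>
        (\<forall>s. ObMap (eta M x) s = (x, s)) \<and>
        (\<forall>s t. s \<le> t \<longrightarrow> ArrMap (eta M x) (s, t) = ((x, s), (x, t))))"
proof (intro conjI ballI allI impI)
  show "eta M \<in> met_hom M (F_obj M)"
    using assms(1) by (intro isometric_embedding_met_hom isometric_embedding_eta)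
next
  fix x assume "x \<in> points M"
  then have "eta M x \<in> points (F_obj M)"
    using isometric_embedding_eta[OF assms(1)] by (auto simp: isometric_embedding_def)
  then show "cat_functor Rcat (spacetime M) (eta M x)"
    by (simp add: F_obj_def pmodule_space_def pmodules_def)
next
  fix x s assume "x \<in> points M"
  then show "ObMap (eta M x) s = (x, s)" by (simp add: eta_eq)
next
  fix x and s t :: real assume "x \<in> points M" "s \<le> t"
  then show "ArrMap (eta M x) (s, t) = ((x, s), (x, t))"
    by (simp add: eta_eq path_pmodule_def)
qed (use assms in \<open>simp_all add: metric_sp_F_obj F_map_met_hom F_map_met_id F_map_compose
      eta_natural isometric_embedding_eta\<close>)

end
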